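(* The following two statements are equivalent. (i) For every natural number $n>3$ the system of equations $$\begin{cases}\phi(n-x)+1=n-x\\ \phi(n+x)+1=n+x\end{cases}$$ has an integral solution $x$. (ii) For every natural number $n>3$ there exists an integer $x$ with $0\le x\le n-3$ such that $$(n-x)^{\phi(p)}\equiv 1 \pmod p\quad\text{for every prime } p\le \lfloor\sqrt{n-x}\rfloor,$$ and $$(n+x)^{\phi(q)}\equiv 1 \pmod q\quad\text{for every prime } q\le \lfloor\sqrt{n+x}\rfloor .$$
   Context: $\phi:\mathbb{N}\to\mathbb{N}$ is Euler's totient function on the positive integers: $\phi(a)$ is the number of integers among $1,2,\dots,a$ that are coprime to $a$. Since $\phi$ is defined only on positive integers, a solution $x$ of the system in (i) is an integer for which $n-x$ and $n+x$ are positive. If there are no primes in the indicated range, the corresponding congruence condition is vacuous. *)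

theory Defs
  imports Complex_Main "HOL-Number_Theory.Number_Theory"
begin

end

theory Submission
  imports Defs
begin

text \<open>
  Both systems say that \<open>n - x\<close> and \<open>n + x\<close> are prime: for the congruences this is Euler's theorem
  together with trial division up to the square root. A solution of the totient system may be replaced
  by its absolute value, and \<open>x = n - 2\<close> is excluded because \<open>n + x\<close> would be even and greater than 2.
\<close>

lemma prime_iff_totient_Suc: "prime (m::nat) \<longleftrightarrow> totient m + 1 = m"
proof
  assume "prime m"
  then show "totient m + 1 = m"
    using prime_gt_0_nat[of m] by (simp add: totient_prime)
next
  assume m: "totient m + 1 = m"
  \<comment> \<open>The values \<open>totient 0 = 0\<close> and \<open>totient 1 = 1\<close> rule
    out the two small cases.\<close>
  then have "m > 1"
    by (cases "m = 0 \<or> m = 1") auto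
  moreover have "totient m = m - 1"
    using m by simp
  ultimately show "prime m"
    using totient_imp_prime by simp
qed

text \<open>In a nontrivial factorization \<open>m = a * b\<close> with \<open>a \<le> b\<close> the
  smaller factor satisfies \<open>a * a \<le> m\<close>, so any prime divisor of \<open>a\<close>
  will do.\<close>

lemma composite_nat_prime_divisor_le_sqrt:
  fixes m :: nat
  assumes "m > 1" "\<not> prime m"
  obtains p where "prime p" "p dvd m" "p\<^sup>2 \<le> m"
proof -
  obtain a b where ab: "m = a * b" "a \<noteq> 1" "b \<noteq> 1" "a \<le> b"
  proof -
    obtain a where a: "a dvd m" "a \<noteq> 1" "a \<noteq> m"
      using assms by (auto simp: prime_nat_iff)
    then obtain b where b: "m = a * b"
      by blast
    then have "b \<noteq> 1" "m = b * a"
      using a by auto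
    with a b show thesis
      using that[of a b] that[of b a] by linarith
  qed
  obtain p where p: "prime p" "p dvd a"
    using ab prime_factor_nat by blast
  have "a > 0" using ab assms by (cases a) auto
  then have "p \<le> a" using p dvd_imp_le by blast
  then have "p\<^sup>2 \<le> m"
    using ab by (auto simp: power2_eq_square intro!: mult_mono)
  with p ab that show thesis by auto
qed

text \<open>For a single prime \<open>p\<close> the congruence just says that \<open>p\<close> does
  not divide \<open>k\<close>, so the right-hand side is trial division. At \<open>k = 1\<close> no
  prime is in range and the congruences hold vacuously, hence the assumption
  \<open>k > 1\<close>.\<close>

lemma prime_iff_power_totient_cong:
  fixes k :: int
  assumes "k > 1"
  shows "prime (nat k) \<longleftrightarrow>
    (\<forall>p::nat. prime p \<and> int p \<le> \<lfloor>sqrt (real_of_int k)\<rfloor> \<longrightarrow> [k ^ totient p = 1] (mod int p))"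
proof -
  define m where "m = nat k"
  have k: "k = int m" and m: "m > 1"
    using assms by (auto simp: m_def)
  have le: "int p \<le> \<lfloor>sqrt (real_of_int k)\<rfloor> \<longleftrightarrow> p\<^sup>2 \<le> m" for p
  proof -
    have "int p \<le> \<lfloor>sqrt (real_of_int k)\<rfloor> \<longleftrightarrow> real p \<le> sqrt (real m)"
      by (simp add: le_floor_iff k)
    also have "\<dots> \<longleftrightarrow> (real p)\<^sup>2 \<le> real m"
      by (metis abs_of_nat real_le_rsqrt sqrt_ge_absD)
    also have "\<dots> \<longleftrightarrow> p\<^sup>2 \<le> m"
      by (metis of_nat_le_iff of_nat_power)
    finally show ?thesis .
  qed
  have cong: "[k ^ totient p = 1] (mod int p) \<longleftrightarrow> \<not> p dvd m" if "prime p" for p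
  proof -
    have "[k ^ totient p = 1] (mod int p) \<longleftrightarrow> [m ^ totient p = 1] (mod p)"
      unfolding k by (metis cong_int_iff of_nat_1 of_nat_power)
    also have "\<dots> \<longleftrightarrow> coprime m p"
    proof
      assume "[m ^ totient p = 1] (mod p)"
      then have "coprime (m ^ totient p) p"
        using cong_imp_coprime cong_sym coprime_1_left by blast
      \<comment> \<open>Coprimality passes from the power to its base because the exponent
        \<open>totient p\<close> is positive.\<close>
      then show "coprime m p"
        using that prime_gt_0_nat by simp
    qed (rule euler_theorem)
    also have "\<dots> \<longleftrightarrow> \<not> p dvd m"
      using that by (auto simp: coprime_commute[of m] prime_imp_coprime dest: coprime_absorb_left not_prime_unit)
    finally show ?thesis .
  qed
  have "prime m \<longleftrightarrow> (\<forall>p. prime p \<and> p\<^sup>2 \<le> m \<longrightarrow> \<not> p dvd m)"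
  proof
    assume pm: "prime m"
    show "\<forall>p. prime p \<and> p\<^sup>2 \<le> m \<longrightarrow> \<not> p dvd m"
    proof (intro allI impI notI)
      fix p assume p: "prime p \<and> p\<^sup>2 \<le> m" "p dvd m"
      \<comment> \<open>A prime divisor of the prime \<open>m\<close> is \<open>m\<close> itself,
        which is too large for the range.\<close>
      then have "m\<^sup>2 \<le> m"
        using pm primes_dvd_imp_eq by blast
      then show False
        using m by (simp add: power2_eq_square)
    qed
  next
    assume "\<forall>p. prime p \<and> p\<^sup>2 \<le> m \<longrightarrow> \<not> p dvd m"
    then show "prime m"
      using composite_nat_prime_divisor_le_sqrt m by metis
  qed
  then show ?thesis
    using le cong m_def by auto
qed

theorem theorem3p4:
  "(\<forall>n::nat. n > 3 \<longrightarrow>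
      (\<exists>x::int. int n - x > 0 \<and> int n + x > 0 \<and>
         int (totient (nat (int n - x))) + 1 = int n - x \<and>
         int (totient (nat (int n + x))) + 1 = int n + x))
   \<longleftrightarrow>
   (\<forall>n::nat. n > 3 \<longrightarrow>
      (\<exists>x::int. 0 \<le> x \<and> x \<le> int n - 3 \<and>
         (\<forall>p::nat. prime p \<and> int p \<le> \<lfloor>sqrt (real_of_int (int n - x))\<rfloor> \<longrightarrow>
            [(int n - x) ^ totient p = 1] (mod int p)) \<and>
         (\<forall>q::nat. prime q \<and> int q \<le> \<lfloor>sqrt (real_of_int (int n + x))\<rfloor> \<longrightarrow>
            [(int n + x) ^ totient q = 1] (mod int q))))"
  (is "(\<forall>n. _ n \<longrightarrow> (\<exists>x. ?A n x)) \<longleftrightarrow> (\<forall>n. _ n \<longrightarrow> (\<exists>x. ?B n x))")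
proof -
  \<comment> \<open>For \<open>k \<le> 0\<close> both sides fail, since \<open>nat k\<close> is 0;
    primality thus absorbs the positivity conditions.\<close>
  have tot: "k > 0 \<and> int (totient (nat k)) + 1 = k \<longleftrightarrow> prime (nat k)" for k
    using prime_gt_0_nat[of "nat k"] unfolding prime_iff_totient_Suc[of "nat k"] by linarith
  have A: "?A n x \<longleftrightarrow> prime (nat (int n - x)) \<and> prime (nat (int n + x))" for n x
    using tot by blast
  have B: "?B n x \<longleftrightarrow> 0 \<le> x \<and> x \<le> int n - 3 \<and> prime (nat (int n - x)) \<and> prime (nat (int n + x))"
    if "n > 3" for n x
  proof (cases "0 \<le> x \<and> x \<le> int n - 3")
    case True
    \<comment> \<open>The bounds on \<open>x\<close> keep \<open>n - x\<close> at 3 or more, away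
      from the vacuous case 1.\<close>
    then have "int n - x > 1" "int n + x > 1"
      using that by auto
    then show ?thesis
      by (simp only: prime_iff_power_totient_cong)
  qed blast
  have "(\<exists>x. ?A n x) \<longleftrightarrow> (\<exists>x. ?B n x)" if n: "n > 3" for n
  proof
    assume "\<exists>x. ?A n x"
    then obtain x where "?A n x" ..
    then have x: "prime (nat (int n - x))" "prime (nat (int n + x))"
      unfolding A by simp_all
    \<comment> \<open>For negative \<open>x\<close> the passage to \<open>y\<close> merely swaps
      \<open>n - x\<close> and \<open>n + x\<close>.\<close>
    define y where "y = \<bar>x\<bar>"
    have y: "prime (nat (int n - y))" "prime (nat (int n + y))" "y \<ge> 0"
      using x by (auto simp: y_def abs_if)
    \<comment> \<open>A prime is at least 2, so excluding the value 2 is all that the bound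
      \<open>y \<le> n - 3\<close> requires.\<close>
    have "nat (int n - y) \<noteq> 2"
    proof
      assume "nat (int n - y) = 2"
      then have "nat (int n + y) = 2 * (n - 1)"
        by linarith
      then have "even (nat (int n + y))" "nat (int n + y) \<noteq> 2"
        using n by auto
      then show False
        using primes_dvd_imp_eq[OF two_is_prime_nat y(2)] by linarith
    qed
    then have "y \<le> int n - 3"
      using prime_ge_2_nat[OF y(1)] by linarith
    then have "?B n y"
      using y by (intro B[OF n, THEN iffD2] conjI)
    then show "\<exists>x. ?B n x" ..
  next
    assume "\<exists>x. ?B n x"
    then obtain x where "?B n x" ..
    then have "?A n x"
      unfolding A B[OF n] by (elim conjE) (rule conjI)
    then show "\<exists>x. ?A n x" ..
  qed
  then show ?thesis
    by (rule all_cong)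
qed

end
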